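(* Let $X,Y\subset\mathbb{R}^N$ be compact sets, let $t,s:X\to Y$ be two Borel maps, let $\mu\in\mathcal{P}(X)$, and let $f,g:X\to\mathcal{P}(Y)$ be defined by $f(x)=\delta_{t(x)}$ and $g(x)=\delta_{s(x)}$. Then $$t_\#\mu=s_\#\mu\iff f_\#\mu=g_\#\mu .$$
   Context: $\mathcal{P}(X)$ denotes the set of Borel probability measures on $X$, and $\delta_y$ is the Dirac mass at $y$. The set $\mathcal{P}(Y)$ is endowed with the $1$-Wasserstein distance $W(\nu_1,\nu_2)=\sup\{\int_Y\varphi\,d(\nu_1-\nu_2): \varphi:Y\to\mathbb{R}\ \text{1-Lipschitz}\}$ (Euclidean distance on $Y$), which metrizes the weak* topology, and with the corresponding Borel $\sigma$-algebra. The symbol $\#$ denotes push-forward of measures; thus $t_\#\mu,s_\#\mu\in\mathcal{P}(Y)$, while $f_\#\mu,g_\#\mu$ are Borel probability measures on $(\mathcal{P}(Y),W)$. *)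

theory Defs
  imports "HOL-Probability.Probability"
begin

(* The Borel sigma-algebra of a subset S of a Euclidean space is restrict_space borel S;
   it is carried by a measure object whose space is S. *)

abbreviation borel_on :: "'a::topological_space set \<Rightarrow> 'a measure" where
  "borel_on S \<equiv> restrict_space borel S"

definition probs :: "'a::topological_space set \<Rightarrow> 'a measure set" where
  "probs S = {\<nu>. sets \<nu> = sets (borel_on S) \<and> prob_space \<nu>}"

(* Metric_space requires its distance to be symmetric and nonnegative on the whole type,
   hence the value 0 outside probs Y. *)

definition wasserstein :: "'a::metric_space set \<Rightarrow> 'a measure \<Rightarrow> 'a measure \<Rightarrow> real" where
  "wasserstein Y \<nu>1 \<nu>2 =
     (if \<nu>1 \<in> probs Y \<and> \<nu>2 \<in> probs Y
      then Sup {(\<integral>y. \<phi> y \<partial>\<nu>1) - (\<integral>y. \<phi> y \<partial>\<nu>2) | \<phi> :: 'a \<Rightarrow> real. 1-lipschitz_on Y \<phi>}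
      else 0)"

abbreviation wasserstein_topology :: "'a::metric_space set \<Rightarrow> 'a measure topology" where
  "wasserstein_topology Y \<equiv> Metric_space.mtopology (probs Y) (wasserstein Y)"

definition borel_probs :: "'a::metric_space set \<Rightarrow> 'a measure measure" where
  "borel_probs Y = sigma (probs Y) {U. openin (wasserstein_topology Y) U}"

(* The facts below check the encoding: the supremum is finite and wasserstein Y is a metric
   on probs Y when Y is compact, so wasserstein_topology is its metric topology, and
   y \<mapsto> \<delta>_y is a Borel map from Y to probs Y, so for measurable t the
   push-forward under x \<mapsto> \<delta>_{t x} is given by distr. *)

lemma probsD:
  assumes "\<nu> \<in> probs S"
  shows "prob_space \<nu>" "sets \<nu> = sets (borel_on S)" "space \<nu> = S"
proof -
  show "prob_space \<nu>" and s: "sets \<nu> = sets (borel_on S)"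
    using assms by (auto simp: probs_def)
  show "space \<nu> = S"
    using sets_eq_imp_space_eq[OF s] by (simp add: space_restrict_space)
qed

lemma return_in_probs: "y \<in> Y \<Longrightarrow> return (borel_on Y) y \<in> probs Y"
  by (auto simp: probs_def space_restrict_space intro!: prob_space_return)

lemma lipschitz_integrable:
  fixes \<phi> :: "'a::euclidean_space \<Rightarrow> real"
  assumes Y: "compact Y" and \<nu>: "\<nu> \<in> probs Y" and \<phi>: "L-lipschitz_on Y \<phi>"
  shows "integrable \<nu> \<phi>"
proof -
  interpret prob_space \<nu> using probsD(1)[OF \<nu>] .
  have cont: "continuous_on Y \<phi>"
    by (rule lipschitz_on_continuous_on[OF \<phi>])
  have "bounded (\<phi> ` Y)"
    using compact_continuous_image[OF cont Y] compact_imp_bounded by blast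
  then obtain B where B: "\<And>y. y \<in> Y \<Longrightarrow> norm (\<phi> y) \<le> B"
    by (auto simp: bounded_iff)
  have "\<phi> \<in> borel_measurable \<nu>"
    using borel_measurable_continuous_on_restrict[OF cont]
    by (simp cong: measurable_cong_sets add: probsD(2)[OF \<nu>])
  then show ?thesis
    using B by (intro integrable_const_bound[where B = B] AE_I2) (auto simp: probsD(3)[OF \<nu>])
qed

lemma lipschitz_integral_diff_le:
  fixes \<phi> :: "'a::euclidean_space \<Rightarrow> real"
  assumes Y: "compact Y" and \<nu>: "\<nu>1 \<in> probs Y" "\<nu>2 \<in> probs Y" and \<phi>: "1-lipschitz_on Y \<phi>"
  shows "(\<integral>y. \<phi> y \<partial>\<nu>1) - (\<integral>y. \<phi> y \<partial>\<nu>2) \<le> diameter Y"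
proof -
  interpret p1: prob_space \<nu>1 using probsD(1)[OF \<nu>(1)] .
  interpret p2: prob_space \<nu>2 using probsD(1)[OF \<nu>(2)] .
  have le: "\<phi> x \<le> \<phi> y + diameter Y" if "x \<in> Y" "y \<in> Y" for x y
  proof -
    have "\<phi> x - \<phi> y \<le> dist x y"
      using lipschitz_onD[OF \<phi> that] by (simp add: dist_real_def)
    also have "\<dots> \<le> diameter Y"
      using diameter_bounded_bound[OF compact_imp_bounded[OF Y] that] .
    finally show ?thesis by simp
  qed
  have "(\<integral>x. \<phi> x \<partial>\<nu>1) \<le> \<phi> y + diameter Y" if "y \<in> Y" for y
    using that le lipschitz_integrable[OF Y \<nu>(1) \<phi>]
    by (intro p1.integral_le_const AE_I2) (auto simp: probsD(3)[OF \<nu>(1)])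
  then have "(\<integral>x. \<phi> x \<partial>\<nu>1) - diameter Y \<le> (\<integral>y. \<phi> y \<partial>\<nu>2)"
    using lipschitz_integrable[OF Y \<nu>(2) \<phi>]
    by (intro p2.integral_ge_const AE_I2) (auto simp: probsD(3)[OF \<nu>(2)] diff_le_eq)
  then show ?thesis by simp
qed

lemma integral_diff_le_wasserstein:
  fixes \<phi> :: "'a::euclidean_space \<Rightarrow> real"
  assumes Y: "compact Y" and \<nu>: "\<nu>1 \<in> probs Y" "\<nu>2 \<in> probs Y" and \<phi>: "1-lipschitz_on Y \<phi>"
  shows "(\<integral>y. \<phi> y \<partial>\<nu>1) - (\<integral>y. \<phi> y \<partial>\<nu>2) \<le> wasserstein Y \<nu>1 \<nu>2"
  unfolding wasserstein_def using assms lipschitz_integral_diff_le[OF Y \<nu>]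
  by (auto intro!: cSup_upper bdd_aboveI[where M = "diameter Y"])

lemma wasserstein_le:
  fixes \<nu>1 \<nu>2 :: "'a::euclidean_space measure"
  assumes \<nu>: "\<nu>1 \<in> probs Y" "\<nu>2 \<in> probs Y"
    and le: "\<And>\<phi> :: 'a \<Rightarrow> real. 1-lipschitz_on Y \<phi> \<Longrightarrow>
               (\<integral>y. \<phi> y \<partial>\<nu>1) - (\<integral>y. \<phi> y \<partial>\<nu>2) \<le> c"
  shows "wasserstein Y \<nu>1 \<nu>2 \<le> c"
proof -
  have "1-lipschitz_on Y (\<lambda>_. 0 :: real)"
    by (rule lipschitz_onI) auto
  then have "{(\<integral>y. \<phi> y \<partial>\<nu>1) - (\<integral>y. \<phi> y \<partial>\<nu>2) | \<phi> :: 'a \<Rightarrow> real. 1-lipschitz_on Y \<phi>} \<noteq> {}"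
    by blast
  then show ?thesis
    unfolding wasserstein_def using \<nu> le by (auto intro!: cSup_least)
qed

lemma probs_eqI_lipschitz:
  fixes \<nu>1 \<nu>2 :: "'a::euclidean_space measure"
  assumes Y: "compact Y" and \<nu>: "\<nu>1 \<in> probs Y" "\<nu>2 \<in> probs Y"
    and eq: "\<And>\<phi> :: 'a \<Rightarrow> real. 1-lipschitz_on Y \<phi> \<Longrightarrow> (\<integral>y. \<phi> y \<partial>\<nu>1) = (\<integral>y. \<phi> y \<partial>\<nu>2)"
  shows "\<nu>1 = \<nu>2"
proof -
  define E where "E = (\<inter>) Y ` Collect closed"
  have lim: "(\<lambda>n. 1 - real (Suc n) * (\<integral>y. min (1 / real (Suc n)) (infdist y C) \<partial>\<nu>)) \<longlonglongrightarrow>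
               measure \<nu> (C \<inter> Y)"
    if C: "closed C" "C \<noteq> {}" and \<nu>: "\<nu> \<in> probs Y" for C and \<nu> :: "'a measure"
  proof -
    interpret prob_space \<nu> using probsD(1)[OF \<nu>] .
    let ?h = "\<lambda>n y. 1 - real (Suc n) * min (1 / real (Suc n)) (infdist y C)"
    have ms: "f \<in> borel_measurable \<nu>" if "f \<in> borel_measurable borel" for f :: "'a \<Rightarrow> real"
      using measurable_restrict_space1[OF that]
      by (simp cong: measurable_cong_sets add: probsD(2)[OF \<nu>])
    have CY: "C \<inter> Y \<in> sets \<nu>"
      using C by (auto simp: probsD(2)[OF \<nu>] sets_restrict_space)
    have "(\<lambda>n. \<integral>y. ?h n y \<partial>\<nu>) \<longlonglongrightarrow> (\<integral>y. indicator (C \<inter> Y) y \<partial>\<nu>)"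
    proof (rule integral_dominated_convergence[where w = "\<lambda>_. 1"])
      show "indicat_real (C \<inter> Y) \<in> borel_measurable \<nu>" using CY by simp
      show "(\<lambda>y. ?h n y) \<in> borel_measurable \<nu>" for n
        by (intro ms borel_measurable_diff borel_measurable_times borel_measurable_min
            borel_measurable_continuous_onI continuous_intros)
      show "AE y in \<nu>. (\<lambda>n. ?h n y) \<longlonglongrightarrow> indicat_real (C \<inter> Y) y"
      proof (rule AE_I2)
        fix y assume "y \<in> space \<nu>"
        then have y: "y \<in> Y" by (simp add: probsD(3)[OF \<nu>])
        show "(\<lambda>n. ?h n y) \<longlonglongrightarrow> indicat_real (C \<inter> Y) y"
        proof (cases "y \<in> C")
          case True
          then show ?thesis using y by (simp add: min_def)
        next
          case False
          then have pos: "infdist y C > 0"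
            using in_closed_iff_infdist_zero[OF C] infdist_nonneg[of y C]
            by (metis order_le_less)
          have "\<forall>\<^sub>F n in sequentially. 1 / real (Suc n) < infdist y C"
            using pos lim_inverse_n' LIMSEQ_Suc[OF lim_inverse_n'] by (intro order_tendstoD(2)) auto
          then have "\<forall>\<^sub>F n in sequentially. 0 = ?h n y"
            by eventually_elim (simp add: min_def)
          then show ?thesis using False by (auto intro: Lim_transform_eventually[OF tendsto_const])
        qed
      qed
      show "AE y in \<nu>. norm (?h n y) \<le> 1" for n
      proof (rule AE_I2)
        fix y
        have "real (Suc n) * min (1 / real (Suc n)) (infdist y C) \<le> real (Suc n) * (1 / real (Suc n))"
          by (intro mult_left_mono) auto
        moreover have "0 \<le> real (Suc n) * min (1 / real (Suc n)) (infdist y C)"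
          by (intro mult_nonneg_nonneg) (auto simp: infdist_nonneg)
        ultimately show "norm (?h n y) \<le> 1" by simp
      qed
    qed simp
    moreover have "(\<integral>y. ?h n y \<partial>\<nu>) =
        1 - real (Suc n) * (\<integral>y. min (1 / real (Suc n)) (infdist y C) \<partial>\<nu>)" for n
    proof -
      have "integrable \<nu> (\<lambda>y. min (1 / real (Suc n)) (infdist y C))"
        by (rule integrable_const_bound[where B = "1 / real (Suc n)"])
           (auto intro!: ms borel_measurable_min borel_measurable_continuous_onI continuous_intros
                 simp: infdist_nonneg)
      then have "(\<integral>y. ?h n y \<partial>\<nu>) =
          (\<integral>y. 1 \<partial>\<nu>) - (\<integral>y. real (Suc n) * min (1 / real (Suc n)) (infdist y C) \<partial>\<nu>)"
        by (intro Bochner_Integration.integral_diff integrable_mult_right) auto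
      then show ?thesis by (simp add: prob_space del: of_nat_Suc)
    qed
    ultimately show ?thesis using CY by (simp add: del: of_nat_Suc)
  qed
  have lip: "1-lipschitz_on Y (\<lambda>y. min (1 / real (Suc n)) (infdist y C))" for n and C :: "'a set"
  proof (rule lipschitz_onI)
    fix x y
    show "dist (min (1 / real (Suc n)) (infdist x C)) (min (1 / real (Suc n)) (infdist y C)) \<le> 1 * dist x y"
      using infdist_triangle_abs[of x C y] unfolding dist_real_def by linarith
  qed simp
  interpret p1: prob_space \<nu>1 using probsD(1)[OF \<nu>(1)] .
  interpret p2: prob_space \<nu>2 using probsD(1)[OF \<nu>(2)] .
  have sE: "sets (borel_on Y) = sigma_sets Y E"
  proof -
    have b: "sets (borel :: 'a measure) = sigma_sets UNIV (Collect closed)"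
      by (subst borel_eq_closed) (rule sets_measure_of, simp)
    have "Y \<in> sigma_sets UNIV (Collect closed)"
      using compact_imp_closed[OF Y] by auto
    then show ?thesis
      unfolding E_def sets_restrict_space b by (rule sigma_sets_Int) simp
  qed
  show ?thesis
  proof (rule measure_eqI_generator_eq[where E = E and \<Omega> = Y and A = "\<lambda>_. Y"])
    show "Int_stable E"
      unfolding E_def
    proof (rule Int_stableI_image)
      fix A B :: "'a set" assume "A \<in> Collect closed" "B \<in> Collect closed"
      then show "\<exists>C\<in>Collect closed. Y \<inter> A \<inter> (Y \<inter> B) = Y \<inter> C"
        by (intro bexI[of _ "A \<inter> B"]) auto
    qed
    show "E \<subseteq> Pow Y" by (auto simp: E_def)
    show "emeasure \<nu>1 S = emeasure \<nu>2 S" if "S \<in> E" for S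
    proof -
      from that obtain C where "C \<in> Collect closed" "S = Y \<inter> C"
        unfolding E_def by (elim imageE)
      then have C: "closed C" "S = C \<inter> Y" by (simp_all add: Int_commute)
      show ?thesis
      proof (cases "C = {}")
        case False
        have "measure \<nu>1 S = measure \<nu>2 S"
          unfolding C(2)
          using lim[OF C(1) False \<nu>(1), unfolded eq[OF lip]] lim[OF C(1) False \<nu>(2)]
          by (rule LIMSEQ_unique)
        then show ?thesis
          by (simp add: p1.emeasure_eq_measure p2.emeasure_eq_measure)
      qed (simp add: C)
    qed
    show "sets \<nu>1 = sigma_sets Y E" "sets \<nu>2 = sigma_sets Y E"
      using sE probsD(2) \<nu> by auto
    have "Y \<in> E" unfolding E_def by (rule image_eqI[of _ _ UNIV]) auto
    then show "range (\<lambda>_::nat. Y) \<subseteq> E" by blast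
  qed auto
qed

lemma Metric_space_wasserstein:
  fixes Y :: "'a::euclidean_space set"
  assumes Y: "compact Y"
  shows "Metric_space (probs Y) (wasserstein Y)"
proof
  have minus: "1-lipschitz_on Y (\<lambda>y. - \<phi> y)" if "1-lipschitz_on Y \<phi>" for \<phi> :: "'a \<Rightarrow> real"
    using that by simp
  have le: "wasserstein Y x y \<le> wasserstein Y y x" for x y
  proof (cases "x \<in> probs Y \<and> y \<in> probs Y")
    case True
    show ?thesis
    proof (rule wasserstein_le)
      fix \<phi> :: "'a \<Rightarrow> real" assume "1-lipschitz_on Y \<phi>"
      from integral_diff_le_wasserstein[OF Y _ _ minus[OF this], of y x] True
      show "(\<integral>z. \<phi> z \<partial>x) - (\<integral>z. \<phi> z \<partial>y) \<le> wasserstein Y y x" by simp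
    qed (use True in auto)
  qed (auto simp: wasserstein_def)
  show "wasserstein Y x y = wasserstein Y y x" for x y
    using le[of x y] le[of y x] by simp
  have zero_lip: "1-lipschitz_on Y (\<lambda>_. 0 :: real)"
    by (rule lipschitz_onI) auto
  show "0 \<le> wasserstein Y x y" for x y
  proof (cases "x \<in> probs Y \<and> y \<in> probs Y")
    case True
    then show ?thesis using integral_diff_le_wasserstein[OF Y _ _ zero_lip, of x y] by simp
  qed (auto simp: wasserstein_def)
  show "wasserstein Y x y = 0 \<longleftrightarrow> x = y" if xy: "x \<in> probs Y" "y \<in> probs Y" for x y
  proof
    assume 0: "wasserstein Y x y = 0"
    then have "wasserstein Y y x = 0" using le[of y x] le[of x y] \<open>0 \<le> wasserstein Y y x\<close> by simp
    with 0 show "x = y"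
      using integral_diff_le_wasserstein[OF Y xy] integral_diff_le_wasserstein[OF Y xy(2,1)]
      by (intro probs_eqI_lipschitz[OF Y xy] order_antisym) (simp_all add: diff_le_0_iff_le)
  next
    assume "x = y"
    then have "wasserstein Y x y \<le> 0" using xy by (intro wasserstein_le) auto
    then show "wasserstein Y x y = 0" using \<open>0 \<le> wasserstein Y x y\<close> by simp
  qed
  show "wasserstein Y x z \<le> wasserstein Y x y + wasserstein Y y z"
    if xyz: "x \<in> probs Y" "y \<in> probs Y" "z \<in> probs Y" for x y z
  proof (rule wasserstein_le)
    fix \<phi> :: "'a \<Rightarrow> real" assume \<phi>: "1-lipschitz_on Y \<phi>"
    show "(\<integral>w. \<phi> w \<partial>x) - (\<integral>w. \<phi> w \<partial>z) \<le> wasserstein Y x y + wasserstein Y y z"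
      using integral_diff_le_wasserstein[OF Y xyz(1,2) \<phi>]
        integral_diff_le_wasserstein[OF Y xyz(2,3) \<phi>] by simp
  qed (use xyz in auto)
qed

lemma borel_probs_simps:
  assumes "compact (Y :: 'a::euclidean_space set)"
  shows "space (borel_probs Y) = probs Y"
    and "sets (borel_probs Y) = sigma_sets (probs Y) {U. openin (wasserstein_topology Y) U}"
proof -
  interpret Metric_space "probs Y" "wasserstein Y" by (rule Metric_space_wasserstein) fact
  have "{U. openin mtopology U} \<subseteq> Pow (probs Y)"
    using openin_subset by fastforce
  then show "space (borel_probs Y) = probs Y"
    and "sets (borel_probs Y) = sigma_sets (probs Y) {U. openin mtopology U}"
    by (auto simp: borel_probs_def space_measure_of_conv)
qed

lemma measurable_return_borel_probs:
  fixes Y :: "'a::euclidean_space set"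
  assumes Y: "compact Y"
  shows "return (borel_on Y) \<in> borel_on Y \<rightarrow>\<^sub>M borel_probs Y"
proof -
  interpret Metric_space "probs Y" "wasserstein Y" by (rule Metric_space_wasserstein) fact
  let ?d = "return (borel_on Y)"
  have le: "wasserstein Y (?d x) (?d y) \<le> dist x y" if xy: "x \<in> Y" "y \<in> Y" for x y
  proof (rule wasserstein_le)
    fix \<phi> :: "'a \<Rightarrow> real" assume \<phi>: "1-lipschitz_on Y \<phi>"
    have "\<phi> \<in> borel_measurable (borel_on Y)"
      by (rule borel_measurable_continuous_on_restrict[OF lipschitz_on_continuous_on[OF \<phi>]])
    then show "(\<integral>z. \<phi> z \<partial>?d x) - (\<integral>z. \<phi> z \<partial>?d y) \<le> dist x y"
      using xy lipschitz_onD[OF \<phi> xy]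
      by (simp add: integral_return space_restrict_space dist_real_def)
  qed (use xy return_in_probs in auto)
  show ?thesis
    unfolding borel_probs_def
  proof (rule measurable_measure_of)
    show "{U. openin mtopology U} \<subseteq> Pow (probs Y)"
      using openin_subset by fastforce
    show "?d \<in> space (borel_on Y) \<rightarrow> probs Y"
      using return_in_probs by (auto simp: space_restrict_space)
    fix U assume "U \<in> {U. openin mtopology U}"
    then have U: "\<And>x. x \<in> U \<Longrightarrow> \<exists>r>0. mball x r \<subseteq> U"
      by (simp add: openin_mtopology)
    have "openin (top_of_set Y) (?d -` U \<inter> Y)"
      unfolding openin_euclidean_subtopology_iff
    proof (intro conjI ballI)
      fix x assume x: "x \<in> ?d -` U \<inter> Y"
      then obtain r where r: "r > 0" "mball (?d x) r \<subseteq> U" using U by auto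
      have "?d y \<in> U" if "y \<in> Y" "dist y x < r" for y
      proof -
        have "wasserstein Y (?d x) (?d y) < r"
          using le[of x y] that x by (simp add: dist_commute)
        then have "?d y \<in> mball (?d x) r"
          using that x return_in_probs[of x Y] return_in_probs[of y Y] by (simp add: in_mball)
        then show ?thesis using r(2) by blast
      qed
      then show "\<exists>e>0. \<forall>y\<in>Y. dist y x < e \<longrightarrow> y \<in> ?d -` U \<inter> Y"
        using r by auto
    qed auto
    then obtain T where "open T" "?d -` U \<inter> Y = Y \<inter> T" by (auto simp: openin_open)
    then show "?d -` U \<inter> space (borel_on Y) \<in> sets (borel_on Y)"
      by (auto simp: space_restrict_space sets_restrict_space)
  qed
qed

end

theory Submission
  imports Defs
begin

text \<open>
  Both \<open>f\<close> and \<open>g\<close> factor through the one map \<open>\<delta> : y \<mapsto> \<delta>\<^sub>y\<close>, so that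
  \<open>f # \<mu> = \<delta> # (t # \<mu>)\<close> and \<open>g # \<mu> = \<delta> # (s # \<mu>)\<close>. The equivalence therefore says that
  push-forward under \<open>\<delta>\<close> is injective on measures on \<open>Y\<close> (\<open>distr_return_inject\<close>).
  A push-forward determines the original measure as soon as every measurable set of the source is the
  preimage of a measurable set of the target, and for \<open>\<delta>\<close> this can be checked on open sets:
  \<open>\<delta>\<close> is a topological embedding of \<open>Y\<close> into the Wasserstein space. If \<open>V = Y - C\<close> with
  \<open>C\<close> closed and nonempty, the Lipschitz test function \<open>y \<mapsto> d(y, C)\<close> makes
  \<open>{\<nu>. \<integral> d(y, C) d\<nu>(y) > 0}\<close> Wasserstein-open, and this set contains \<open>\<delta>\<^sub>y\<close> exactly for
  \<open>y \<in> V\<close>.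
\<close>

text \<open>By definition of the Wasserstein distance as a supremum, \<open>\<nu> \<mapsto> \<integral> \<phi> d\<nu>\<close> is
  1-Lipschitz for it; so the set below contains the ball of radius \<open>\<integral> \<phi> d\<nu>\<close> about each of
  its points \<open>\<nu>\<close>.\<close>

lemma openin_wasserstein_integral_pos:
  fixes \<phi> :: "'a::euclidean_space \<Rightarrow> real"
  assumes Y: "compact Y" and \<phi>: "1-lipschitz_on Y \<phi>"
  shows "openin (wasserstein_topology Y) {\<nu> \<in> probs Y. 0 < (\<integral>y. \<phi> y \<partial>\<nu>)}"
proof -
  interpret Metric_space "probs Y" "wasserstein Y" by (rule Metric_space_wasserstein[OF Y])
  let ?U = "{\<nu> \<in> probs Y. 0 < (\<integral>y. \<phi> y \<partial>\<nu>)}"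
  have "mball \<nu> (\<integral>y. \<phi> y \<partial>\<nu>) \<subseteq> ?U" for \<nu>
  proof
    fix \<nu>' assume "\<nu>' \<in> mball \<nu> (\<integral>y. \<phi> y \<partial>\<nu>)"
    then have "\<nu> \<in> probs Y" "\<nu>' \<in> probs Y" "wasserstein Y \<nu> \<nu>' < (\<integral>y. \<phi> y \<partial>\<nu>)"
      by (auto simp: in_mball)
    then show "\<nu>' \<in> ?U"
      using integral_diff_le_wasserstein[OF Y _ _ \<phi>, of \<nu> \<nu>'] by simp
  qed
  then show ?thesis by (auto simp: openin_mtopology)
qed

lemma open_Int_eq_vimage_return:
  fixes Y V :: "'a::euclidean_space set"
  assumes Y: "compact Y" and V: "open V"
  shows "\<exists>U \<in> sets (borel_probs Y). Y \<inter> V = return (borel_on Y) -` U \<inter> Y"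
proof (cases "V = UNIV")
  \<comment> \<open>Here the complement is empty, and the distance to it is 0 by convention.\<close>
  case True
  have "Y \<inter> V = return (borel_on Y) -` space (borel_probs Y) \<inter> Y"
    using True return_in_probs by (auto simp: borel_probs_simps(1)[OF Y])
  then show ?thesis by blast
next
  case False
  define \<phi> where "\<phi> y = infdist y (- V)" for y
  let ?U = "{\<nu> \<in> probs Y. 0 < (\<integral>y. \<phi> y \<partial>\<nu>)}"
  have lip: "1-lipschitz_on Y \<phi>"
    using infdist_triangle_abs by (intro lipschitz_onI) (auto simp: \<phi>_def dist_real_def)
  have int: "(\<integral>z. \<phi> z \<partial>return (borel_on Y) y) = \<phi> y" if "y \<in> Y" for y
    using that borel_measurable_continuous_on_restrict[OF lipschitz_on_continuous_on[OF lip]]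
    by (simp add: integral_return space_restrict_space)
  have pos: "0 < \<phi> y \<longleftrightarrow> y \<in> V" for y
  proof -
    have "- V \<noteq> {}" using False by blast
    then have "y \<in> - V \<longleftrightarrow> \<phi> y = 0"
      unfolding \<phi>_def using V by (intro in_closed_iff_infdist_zero) (auto simp: closed_Compl)
    then show ?thesis using infdist_nonneg[of y "- V"] by (auto simp: \<phi>_def order_le_less)
  qed
  have "?U \<in> sets (borel_probs Y)"
    unfolding borel_probs_simps(2)[OF Y]
    using openin_wasserstein_integral_pos[OF Y lip] by (auto intro: sigma_sets.Basic)
  moreover have "Y \<inter> V = return (borel_on Y) -` ?U \<inter> Y"
    using int pos return_in_probs by auto
  ultimately show ?thesis by blast
qed

text \<open>The preimages of measurable sets form a \<open>\<sigma>\<close>-algebra on \<open>Y\<close>, so the case of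
  open sets suffices.\<close>

lemma borel_on_eq_vimage_return:
  fixes Y :: "'a::euclidean_space set"
  assumes Y: "compact Y" and A: "A \<in> sets (borel_on Y)"
  shows "\<exists>U \<in> sets (borel_probs Y). A = return (borel_on Y) -` U \<inter> Y"
proof -
  let ?d = "return (borel_on Y)"
  from A obtain B :: "'a set" where B: "B \<in> sets borel" "A = Y \<inter> B"
    by (auto simp: sets_restrict_space)
  have "B \<in> sigma_sets UNIV {S. open S}"
    using B(1) by (simp add: borel_def)
  then have "\<exists>U \<in> sets (borel_probs Y). Y \<inter> B = ?d -` U \<inter> Y"
  proof induction
    case (Basic V)
    then show ?case using open_Int_eq_vimage_return[OF Y] by simp
  next
    case Empty
    show ?case by (intro bexI[of _ "{}"]) auto
  next
    case (Compl V)
    then obtain U where "U \<in> sets (borel_probs Y)" "Y \<inter> V = ?d -` U \<inter> Y" by blast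
    then have "Y \<inter> (UNIV - V) = ?d -` (space (borel_probs Y) - U) \<inter> Y"
      using return_in_probs by (fastforce simp: borel_probs_simps(1)[OF Y])
    then show ?case
      using sets.compl_sets[OF \<open>U \<in> sets (borel_probs Y)\<close>] by blast
  next
    case (Union V)
    then obtain U where U: "\<And>i::nat. U i \<in> sets (borel_probs Y)"
      "\<And>i. Y \<inter> V i = ?d -` U i \<inter> Y"
      by metis
    have "x \<in> V i \<longleftrightarrow> ?d x \<in> U i" if "x \<in> Y" for x i
      using U(2)[of i] that by blast
    then have "Y \<inter> (\<Union>i. V i) = ?d -` (\<Union>i. U i) \<inter> Y" by auto
    moreover have "(\<Union>i. U i) \<in> sets (borel_probs Y)" using U(1) by blast
    ultimately show ?case by blast
  qed
  then show ?thesis using B(2) by simp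
qed

lemma distr_return_inject:
  fixes Y :: "'a::euclidean_space set"
  assumes Y: "compact Y"
    and sets: "sets \<nu>1 = sets (borel_on Y)" "sets \<nu>2 = sets (borel_on Y)"
    and eq: "distr \<nu>1 (borel_probs Y) (return (borel_on Y)) =
             distr \<nu>2 (borel_probs Y) (return (borel_on Y))"
  shows "\<nu>1 = \<nu>2"
proof (rule measure_eqI)
  show "sets \<nu>1 = sets \<nu>2" using sets by simp
next
  let ?d = "return (borel_on Y)"
  fix A assume "A \<in> sets \<nu>1"
  then obtain U where U: "U \<in> sets (borel_probs Y)" "A = ?d -` U \<inter> Y"
    using borel_on_eq_vimage_return[OF Y] sets(1) by blast
  have "emeasure (distr \<nu> (borel_probs Y) ?d) U = emeasure \<nu> A"
    if "sets \<nu> = sets (borel_on Y)" for \<nu>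
  proof -
    have "?d \<in> \<nu> \<rightarrow>\<^sub>M borel_probs Y"
      using measurable_return_borel_probs[OF Y] by (simp cong: measurable_cong_sets add: that)
    moreover have "space \<nu> = Y"
      using sets_eq_imp_space_eq[OF that] by (simp add: space_restrict_space)
    ultimately show ?thesis using U by (simp add: emeasure_distr)
  qed
  from this[OF sets(1)] this[OF sets(2)] show "emeasure \<nu>1 A = emeasure \<nu>2 A"
    using eq by simp
qed

theorem lemma1p3:
  fixes X Y :: "(real ^ 'n) set"
    and t s :: "real ^ 'n \<Rightarrow> real ^ 'n"
    and \<mu> :: "(real ^ 'n) measure"
    and f g :: "real ^ 'n \<Rightarrow> (real ^ 'n) measure"
  assumes "compact X" and "compact Y"
    and "t \<in> borel_on X \<rightarrow>\<^sub>M borel_on Y"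
    and "s \<in> borel_on X \<rightarrow>\<^sub>M borel_on Y"
    and "\<mu> \<in> probs X"
    and "\<And>x. x \<in> X \<Longrightarrow> f x = return (borel_on Y) (t x)"
    and "\<And>x. x \<in> X \<Longrightarrow> g x = return (borel_on Y) (s x)"
  shows "distr \<mu> (borel_on Y) t = distr \<mu> (borel_on Y) s \<longleftrightarrow>
         distr \<mu> (borel_probs Y) f = distr \<mu> (borel_probs Y) g"
proof -
  let ?d = "return (borel_on Y)"
  have factor: "distr \<mu> (borel_probs Y) h = distr (distr \<mu> (borel_on Y) r) (borel_probs Y) ?d"
    if r: "r \<in> borel_on X \<rightarrow>\<^sub>M borel_on Y" and h: "\<And>x. x \<in> X \<Longrightarrow> h x = ?d (r x)"
    for r :: "real ^ 'n \<Rightarrow> real ^ 'n" and h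
  proof -
    have "r \<in> \<mu> \<rightarrow>\<^sub>M borel_on Y"
      using r by (simp cong: measurable_cong_sets add: probsD(2)[OF \<open>\<mu> \<in> probs X\<close>])
    then have "distr (distr \<mu> (borel_on Y) r) (borel_probs Y) ?d = distr \<mu> (borel_probs Y) (?d \<circ> r)"
      by (rule distr_distr[OF measurable_return_borel_probs[OF \<open>compact Y\<close>]])
    also have "\<dots> = distr \<mu> (borel_probs Y) h"
      using h by (intro distr_cong) (auto simp: probsD(3)[OF \<open>\<mu> \<in> probs X\<close>])
    finally show ?thesis by simp
  qed
  have "distr \<mu> (borel_probs Y) f = distr (distr \<mu> (borel_on Y) t) (borel_probs Y) ?d"
    using assms by (intro factor) auto
  moreover have "distr \<mu> (borel_probs Y) g = distr (distr \<mu> (borel_on Y) s) (borel_probs Y) ?d"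
    using assms by (intro factor) auto
  ultimately show ?thesis
    using distr_return_inject[OF \<open>compact Y\<close>, of "distr \<mu> (borel_on Y) t" "distr \<mu> (borel_on Y) s"]
    by auto
qed

end
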